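(* Let $S\subset\mathbb{N}^p$ be a $\mathcal{C}_S$-semigroup and let $\tau_1,\ldots,\tau_q$ be the extremal rays of $L(S)$. For each $i\in[q]$ and each $\alpha\in\Upsilon_i(\mathcal{D})\setminus\{0\}$, let $\mathbf{m}^{(i)}_\alpha$ be the element of $\upsilon_i(\alpha)\cap S$ (a non-empty set) with minimal 1-norm. Let $$n_i=\|\mathbf{c}_i\|_1+\max\{\|\mathbf{m}^{(i)}_\alpha\|_1\mid \alpha\in\Upsilon_i(\mathcal{D})\setminus\{0\}\},$$ and let $\mathbf{x}_i$ be the minimal element of $\tau_i\cap S$ such that $\|\mathbf{x}_i\|_1\ge n_i$. Then $$\mathcal{C}_S\setminus S\subset\Big\{\sum_{i\in[q]}\lambda_i\mathbf{x}_i\;\Big|\;0\le\lambda_i\le 1\Big\}.$$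
   Context: $\mathbb{N}$ is the set of non-negative integers, $[n]=\{1,\ldots,n\}$, and $\|x\|_1$ is the sum of the absolute values of the entries of $x$. An affine semigroup is a finitely generated submonoid of $\mathbb{N}^p$ (it contains $0$); $\Lambda_S$ denotes its minimal generating set. For $B\subset\mathbb{R}^p_{\ge}$, $L(B)$ is the set of finite linear combinations of elements of $B$ with non-negative real coefficients. Put $\mathcal{C}_S=L(S)\cap\mathbb{N}^p$. $S$ is a $\mathcal{C}_S$-semigroup if $S$ is an affine semigroup and $\mathcal{C}_S\setminus S$ is finite. Let $h_1(x)=0,\ldots,h_t(x)=0$ be the supported hyperplanes of the polyhedral cone $L(S)$ (those defining its facets), where each $h_j$ is a linear form with relatively prime integer coefficients and $L(S)=\{x\in\mathbb{R}^p_{\ge}\mid h_1(x)\ge 0,\ldots,h_t(x)\ge 0\}$. For $i\in[q]$, let $J_i=\{j_1<\cdots<j_{p-1}\}\subset[t]$ be the index set of the supported hyperplanes containing the extremal ray $\tau_i$; it is assumed to have $p-1$ elements and the equations $h_j(x)=0$, $j\in J_i$, determine $\tau_i$ (their common solution set is the line spanned by $\tau_i$). Let $\mathbf{a}_i$ be the minimal non-zero non-negative integer vector with $\tau_i=\{\lambda\mathbf{a}_i\mid\lambda\in\mathbb{R}_{\ge}\}$. Elements of $\tau_i$ are ordered by their coefficient $\lambda$. For $\alpha=(\alpha_{j_1},\ldots,\alpha_{j_{p-1}})\in\mathbb{Z}^{p-1}$, $\upsilon_i(\alpha)$ is the line of solutions $x\in\mathbb{R}^p$ of $h_j(x)=\alpha_j$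 for all $j\in J_i$. For $P\in\mathcal{C}_S$, $\Upsilon_i(P)=(h_{j_1}(P),\ldots,h_{j_{p-1}}(P))\in\mathbb{N}^{p-1}$. For $i\in[q]$, $\mathbf{s}_i$ is the minimum element of $\Lambda_S\cap\tau_i$, and $\mathcal{D}=\{\sum_{i\in[q]}\lambda_i\mathbf{s}_i\mid 0\le\lambda_i\le 1\}\cap\mathbb{N}^p$. The Frobenius element $\mathbf{f}_i$ is the maximal element of the finite set $\tau_i\cap(\mathcal{C}_S\setminus S)$, with $\mathbf{f}_i=-\mathbf{a}_i$ if this set is empty; the conductor of $\tau_i\cap S$ is $\mathbf{c}_i=\mathbf{f}_i+\mathbf{a}_i$. *)

theory Defs
  imports "HOL-Analysis.Analysis"
begin

(* The ambient space R^p is real^'n with p = CARD('n); N^p is its subset nat_points. *)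

definition nat_points :: "(real^'n) set" where
  "nat_points = {x. \<forall>k. x $ k \<in> \<nat>}"

definition norm1 :: "real^'n \<Rightarrow> real" where
  "norm1 x = (\<Sum>k\<in>UNIV. \<bar>x $ k\<bar>)"


section \<open>Affine semigroups and their cones\<close>

definition add_submonoid :: "'a::comm_monoid_add set \<Rightarrow> bool" where
  "add_submonoid M \<longleftrightarrow> 0 \<in> M \<and> (\<forall>x\<in>M. \<forall>y\<in>M. x + y \<in> M)"

definition affine_semigroup :: "(real^'n) set \<Rightarrow> bool" where
  "affine_semigroup S \<longleftrightarrow>
     S \<subseteq> nat_points \<and> (\<exists>G. finite G \<and> add_submonoid hull G = S)"

definition min_gens :: "'a::comm_monoid_add set \<Rightarrow> 'a set" where
  "min_gens S = (THE A. add_submonoid hull A = S \<and>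
                        (\<forall>B. B \<subset> A \<longrightarrow> add_submonoid hull B \<noteq> S))"

definition cone_span :: "'a::real_vector set \<Rightarrow> 'a set" where
  "cone_span B = {\<Sum>b\<in>F. c b *\<^sub>R b | F c. finite F \<and> F \<subseteq> B \<and> (\<forall>b\<in>F. 0 \<le> c b)}"

definition cone_points :: "(real^'n) set \<Rightarrow> (real^'n) set" where
  "cone_points S = cone_span S \<inter> nat_points"

definition C_semigroup :: "(real^'n) set \<Rightarrow> bool" where
  "C_semigroup S \<longleftrightarrow> affine_semigroup S \<and> finite (cone_points S - S)"


section \<open>Supported hyperplanes and extremal rays\<close>

(* A linear form is given by its vector of integer coefficients. *)
definition lin_form :: "int^'n \<Rightarrow> real^'n \<Rightarrow> real" where
  "lin_form a x = (\<Sum>k\<in>UNIV. of_int (a $ k) * x $ k)"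

(* If C is full-dimensional, inj_on makes the indexing of the facets by {1..t} a bijection. *)
definition supported_hyperplanes :: "(real^'n) set \<Rightarrow> nat \<Rightarrow> (nat \<Rightarrow> int^'n) \<Rightarrow> bool" where
  "supported_hyperplanes C t h \<longleftrightarrow>
     (\<forall>j\<in>{1..t}. Gcd (range (\<lambda>k. h j $ k)) = 1) \<and>
     inj_on h {1..t} \<and>
     (\<lambda>j. {x \<in> C. lin_form (h j) x = 0}) ` {1..t} = {F. F facet_of C} \<and>
     C = {x. (\<forall>k. 0 \<le> x $ k) \<and> (\<forall>j\<in>{1..t}. 0 \<le> lin_form (h j) x)}"

definition ray :: "'a::real_vector \<Rightarrow> 'a set" where
  "ray v = {l *\<^sub>R v | l. 0 \<le> l}"

definition extremal_ray :: "'a::real_vector set \<Rightarrow> 'a set \<Rightarrow> bool" where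
  "extremal_ray R C \<longleftrightarrow> R face_of C \<and> (\<exists>v. v \<noteq> 0 \<and> R = ray v)"

definition ray_index :: "nat \<Rightarrow> (nat \<Rightarrow> int^'n) \<Rightarrow> (real^'n) set \<Rightarrow> nat set" where
  "ray_index t h R = {j\<in>{1..t}. \<forall>x\<in>R. lin_form (h j) x = 0}"

(* Least for the componentwise order on real^'n. *)
definition ray_vector :: "(real^'n) set \<Rightarrow> real^'n" where
  "ray_vector R = (LEAST a. a \<in> nat_points \<and> a \<noteq> 0 \<and> R = ray a)"

definition ray_coeff :: "(real^'n) set \<Rightarrow> real^'n \<Rightarrow> real" where
  "ray_coeff R x = (THE l. x = l *\<^sub>R ray_vector R)"


section \<open>Lines parallel to an extremal ray\<close>

(* The tuples indexed by J are functions on nat; the values of form_values are extensional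
   on J, so that the zero tuple is the restriction of the zero function to J. *)
definition level_line :: "(nat \<Rightarrow> int^'n) \<Rightarrow> nat set \<Rightarrow> (nat \<Rightarrow> real) \<Rightarrow> (real^'n) set" where
  "level_line h J \<alpha> = {x. \<forall>j\<in>J. lin_form (h j) x = \<alpha> j}"

definition form_values :: "(nat \<Rightarrow> int^'n) \<Rightarrow> nat set \<Rightarrow> real^'n \<Rightarrow> nat \<Rightarrow> real" where
  "form_values h J P = (\<lambda>j\<in>J. lin_form (h j) P)"

definition zonotope :: "nat \<Rightarrow> (nat \<Rightarrow> 'a::real_vector) \<Rightarrow> 'a set" where
  "zonotope q v = {\<Sum>i\<in>{1..q}. l i *\<^sub>R v i | l. \<forall>i\<in>{1..q}. 0 \<le> l i \<and> l i \<le> 1}"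

definition ray_min_gen :: "(real^'n) set \<Rightarrow> (real^'n) set \<Rightarrow> real^'n" where
  "ray_min_gen S R = arg_min_on (ray_coeff R) (min_gens S \<inter> R)"

definition D_set :: "(real^'n) set \<Rightarrow> nat \<Rightarrow> (nat \<Rightarrow> (real^'n) set) \<Rightarrow> (real^'n) set" where
  "D_set S q \<tau> = zonotope q (\<lambda>i. ray_min_gen S (\<tau> i)) \<inter> nat_points"

definition nonzero_levels ::
    "(real^'n) set \<Rightarrow> nat \<Rightarrow> (nat \<Rightarrow> int^'n) \<Rightarrow> nat \<Rightarrow> (nat \<Rightarrow> (real^'n) set) \<Rightarrow> nat
     \<Rightarrow> (nat \<Rightarrow> real) set" where
  "nonzero_levels S t h q \<tau> i =
     form_values h (ray_index t h (\<tau> i)) ` D_set S q \<tau> - {\<lambda>j\<in>ray_index t h (\<tau> i). 0}"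

definition level_min ::
    "(real^'n) set \<Rightarrow> (nat \<Rightarrow> int^'n) \<Rightarrow> nat set \<Rightarrow> (nat \<Rightarrow> real) \<Rightarrow> real^'n" where
  "level_min S h J \<alpha> = arg_min_on norm1 (level_line h J \<alpha> \<inter> S)"


section \<open>Frobenius elements, conductors and the bounding points\<close>

definition frobenius :: "(real^'n) set \<Rightarrow> (real^'n) set \<Rightarrow> real^'n" where
  "frobenius S R =
     (if R \<inter> (cone_points S - S) = {} then - ray_vector R
      else arg_max_on (ray_coeff R) (R \<inter> (cone_points S - S)))"

definition conductor :: "(real^'n) set \<Rightarrow> (real^'n) set \<Rightarrow> real^'n" where
  "conductor S R = frobenius S R + ray_vector R"

(* Inserting 0 changes nothing when there is a nonzero level, since norm1 is nonnegative; it only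
   sets the maximum to 0 when there is none, as is always the case for p = 1. *)
definition norm_bound ::
    "(real^'n) set \<Rightarrow> nat \<Rightarrow> (nat \<Rightarrow> int^'n) \<Rightarrow> nat \<Rightarrow> (nat \<Rightarrow> (real^'n) set) \<Rightarrow> nat
     \<Rightarrow> real" where
  "norm_bound S t h q \<tau> i =
     norm1 (conductor S (\<tau> i)) +
     Max (insert 0 ((\<lambda>\<alpha>. norm1 (level_min S h (ray_index t h (\<tau> i)) \<alpha>)) `
                      nonzero_levels S t h q \<tau> i))"

definition bound_point ::
    "(real^'n) set \<Rightarrow> nat \<Rightarrow> (nat \<Rightarrow> int^'n) \<Rightarrow> nat \<Rightarrow> (nat \<Rightarrow> (real^'n) set) \<Rightarrow> nat
     \<Rightarrow> real^'n" where
  "bound_point S t h q \<tau> i =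
     arg_min_on (ray_coeff (\<tau> i)) {x \<in> \<tau> i \<inter> S. norm_bound S t h q \<tau> i \<le> norm1 x}"

end

theory Submission
  imports Defs
begin

text \<open>
  Write \<open>s\<^sub>i\<close> for the minimal generator on the ray \<open>\<tau>\<^sub>i\<close> and \<open>x\<^sub>i\<close> for the bounding point.
  Every point of the cone is a combination \<open>P = \<Sum> \<mu>\<^sub>i s\<^sub>i\<close> with \<open>\<mu>\<^sub>i \<ge> 0\<close>, because the cone is
  generated by its extremal rays (\<open>closed_cone_subset_if_extremal_rays\<close>). If every term
  \<open>\<mu>\<^sub>i s\<^sub>i\<close> is at most as long as \<open>x\<^sub>i\<close>, then \<open>\<mu>\<^sub>i s\<^sub>i = \<lambda>\<^sub>i x\<^sub>i\<close> with \<open>0 \<le> \<lambda>\<^sub>i \<le> 1\<close> and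
  \<open>P\<close> lies in the zonotope.

  Otherwise some term \<open>\<mu>\<^sub>i s\<^sub>i\<close> is longer than \<open>x\<^sub>i\<close>, and then \<open>P\<close> is in \<open>S\<close>, for any
  choice of the \<open>\<mu>\<^sub>i\<close>. Indeed, let \<open>d\<close> be the combination of the \<open>s\<^sub>j\<close> with the fractional
  parts of the \<open>\<mu>\<^sub>j\<close>. It is a natural point, so it belongs to \<open>D\<close>. The point
  \<open>w = d + \<lfloor>\<mu>\<^sub>i\<rfloor> s\<^sub>i\<close> has length at least that of \<open>\<mu>\<^sub>i s\<^sub>i\<close>, hence at least \<open>n\<^sub>i\<close>, and it lies on
  the line through \<open>d\<close> parallel to \<open>\<tau>\<^sub>i\<close>. This line contains a point \<open>m\<close> of \<open>S\<close>: the shortest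
  one, or \<open>0\<close> if \<open>d\<close> itself is on \<open>\<tau>\<^sub>i\<close>. By the choice of \<open>n\<^sub>i\<close> the difference \<open>w - m\<close> is at
  least as long as the conductor, so it is in \<open>S\<close>, and so is \<open>w\<close>
  (\<open>far_point_in_semigroup\<close>). Adding \<open>\<lfloor>\<mu>\<^sub>j\<rfloor> s\<^sub>j\<close> for \<open>j \<noteq> i\<close> gives \<open>P\<close> in \<open>S\<close>.

  The rest of the argument is about the minima and maxima in the definitions being attained. Those
  that are taken over natural points exist because the 1-norm and the coefficient along a ray are
  then natural numbers (\<open>arg_min_on_Nats\<close>).
\<close>

section \<open>Non-negative and natural points\<close>

lemma nat_points_nonneg: "x \<in> nat_points \<Longrightarrow> 0 \<le> x"
  by (auto simp: nat_points_def less_eq_vec_def Nats_altdef2)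

lemma nat_points_iff: "x \<in> nat_points \<longleftrightarrow> 0 \<le> x \<and> (\<forall>k. x $ k \<in> \<int>)"
  by (auto simp: nat_points_def less_eq_vec_def Nats_altdef2)

lemma nat_points_add: "x \<in> nat_points \<Longrightarrow> y \<in> nat_points \<Longrightarrow> x + y \<in> nat_points"
  by (simp add: nat_points_def)

lemma nat_points_scale: "x \<in> nat_points \<Longrightarrow> of_nat n *\<^sub>R x \<in> nat_points"
  by (simp add: nat_points_def)

lemma norm1_nonneg [simp]: "0 \<le> norm1 x"
  by (simp add: norm1_def sum_nonneg)

lemma norm1_zero [simp]: "norm1 0 = 0"
  by (simp add: norm1_def)

lemma norm1_eq_0_iff [simp]: "norm1 x = 0 \<longleftrightarrow> x = 0"
  by (simp add: norm1_def sum_nonneg_eq_0_iff vec_eq_iff)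

lemma norm1_pos: "x \<noteq> 0 \<Longrightarrow> 0 < norm1 x"
  by (metis norm1_eq_0_iff norm1_nonneg order_le_less)

lemma norm1_scaleR: "norm1 (c *\<^sub>R x) = \<bar>c\<bar> * norm1 x"
  by (simp add: norm1_def abs_mult sum_distrib_left)

text \<open>
  On the non-negative orthant the 1-norm is linear, so it measures lengths along parallel lines
  and cuts out a bounded base of a cone.
\<close>

lemma norm1_add: "0 \<le> x \<Longrightarrow> 0 \<le> y \<Longrightarrow> norm1 (x + y) = norm1 x + norm1 y"
  by (simp add: norm1_def less_eq_vec_def sum.distrib)

lemma norm1_sum: "(\<And>i. i \<in> A \<Longrightarrow> 0 \<le> f i) \<Longrightarrow> norm1 (sum f A) = (\<Sum>i\<in>A. norm1 (f i))"
  by (induction A rule: infinite_finite_induct) (auto simp: norm1_add sum_nonneg)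

lemma component_le_norm1: "\<bar>x $ k\<bar> \<le> norm1 x"
  unfolding norm1_def by (rule member_le_sum) auto

lemma norm1_Nats: "x \<in> nat_points \<Longrightarrow> norm1 x \<in> \<nat>"
  unfolding norm1_def nat_points_def by (auto simp: Nats_altdef2 intro!: Ints_sum sum_nonneg Ints_abs)

lemma finite_nat_points_bounded: "finite {x :: real^'n. x \<in> nat_points \<and> norm1 x \<le> b}"
proof (rule finite_subset)
  let ?N = "(real :: nat \<Rightarrow> real) ` {..nat \<lceil>b\<rceil>}"
  let ?F = "{f. \<forall>k. f k \<in> ?N} :: ('n \<Rightarrow> real) set"
  show "{x. x \<in> nat_points \<and> norm1 x \<le> b} \<subseteq> vec_lambda ` ?F"
  proof
    fix x :: "real^'n" assume x: "x \<in> {x. x \<in> nat_points \<and> norm1 x \<le> b}"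
    have "x $ k \<in> ?N" for k
    proof -
      obtain m where m: "x $ k = real m"
        using x by (auto simp: nat_points_def elim: Nats_cases)
      have "real m \<le> b" using component_le_norm1[of x k] x m by simp
      then have "m \<le> nat \<lceil>b\<rceil>" by linarith
      then show ?thesis using m by auto
    qed
    moreover have "x = vec_lambda (\<lambda>k. x $ k)" by simp
    ultimately show "x \<in> vec_lambda ` ?F" by blast
  qed
  have "finite (PiE UNIV (\<lambda>_::'n. ?N))" by (intro finite_PiE) auto
  moreover have "?F = PiE UNIV (\<lambda>_::'n. ?N)" by (auto simp: PiE_def)
  ultimately show "finite (vec_lambda ` ?F)" by simp
qed

text \<open>
  The set may be infinite: naturality of the values is what makes the minimum exist.
\<close>

lemma arg_min_on_Nats:
  fixes f :: "'a \<Rightarrow> real"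
  assumes "f ` A \<subseteq> \<nat>" "A \<noteq> {}"
  shows "arg_min_on f A \<in> A" and "x \<in> A \<Longrightarrow> f (arg_min_on f A) \<le> f x"
proof -
  obtain y where y: "y \<in> A" "\<And>z. z \<in> A \<Longrightarrow> nat \<lfloor>f y\<rfloor> \<le> nat \<lfloor>f z\<rfloor>"
    using ex_has_least_nat[of "\<lambda>z. z \<in> A" _ "\<lambda>z. nat \<lfloor>f z\<rfloor>"] assms(2) by blast
  have f: "f z = real (nat \<lfloor>f z\<rfloor>)" if "z \<in> A" for z
    using assms(1) that by (force elim: Nats_cases)
  have "is_arg_min f (\<lambda>z. z \<in> A) y"
    unfolding is_arg_min_def using y f by (metis not_less of_nat_le_iff)
  then have "is_arg_min f (\<lambda>z. z \<in> A) (arg_min_on f A)"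
    unfolding arg_min_on_def arg_min_def by (rule someI)
  then show "arg_min_on f A \<in> A" and "x \<in> A \<Longrightarrow> f (arg_min_on f A) \<le> f x"
    by (auto simp: is_arg_min_def not_less)
qed

lemma arg_max_on_finite:
  fixes f :: "'a \<Rightarrow> real"
  assumes "finite A" "A \<noteq> {}"
  shows "arg_max_on f A \<in> A" and "x \<in> A \<Longrightarrow> f x \<le> f (arg_max_on f A)"
proof -
  have "Max (f ` A) \<in> f ` A" using assms by simp
  then obtain y where "y \<in> A" "f y = Max (f ` A)" by auto
  then have "is_arg_max f (\<lambda>z. z \<in> A) y"
    using assms by (auto simp: is_arg_max_def not_less)
  then have "is_arg_max f (\<lambda>z. z \<in> A) (arg_max_on f A)"
    unfolding arg_max_on_def arg_max_def by (rule someI)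
  then show "arg_max_on f A \<in> A" and "x \<in> A \<Longrightarrow> f x \<le> f (arg_max_on f A)"
    by (auto simp: is_arg_max_def not_less)
qed

section \<open>Closed cones are generated by their extremal rays\<close>

lemma cone_span_superset: "B \<subseteq> cone_span B"
proof
  fix b assume "b \<in> B"
  then show "b \<in> cone_span B"
    unfolding cone_span_def
    by (intro CollectI exI[of _ "{b}"] exI[of _ "\<lambda>_. 1"]) auto
qed

lemma convex_cone_cone_span: "convex_cone (cone_span B)"
  unfolding convex_cone_iff
proof (intro conjI ballI allI impI)
  show "0 \<in> cone_span B"
    unfolding cone_span_def by (intro CollectI exI[of _ "{}"]) auto
next
  fix x y assume "x \<in> cone_span B" "y \<in> cone_span B"
  then obtain F c G d where F: "finite F" "F \<subseteq> B" "\<forall>b\<in>F. 0 \<le> c b" "x = (\<Sum>b\<in>F. c b *\<^sub>R b)"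
    and G: "finite G" "G \<subseteq> B" "\<forall>b\<in>G. 0 \<le> d b" "y = (\<Sum>b\<in>G. d b *\<^sub>R b)"
    unfolding cone_span_def by blast
  let ?e = "\<lambda>b. (if b \<in> F then c b else 0) + (if b \<in> G then d b else 0)"
  have "x = (\<Sum>b\<in>F \<union> G. (if b \<in> F then c b else 0) *\<^sub>R b)"
    unfolding F(4) by (rule sum.mono_neutral_cong_left) (use F G in auto)
  moreover have "y = (\<Sum>b\<in>F \<union> G. (if b \<in> G then d b else 0) *\<^sub>R b)"
    unfolding G(4) by (rule sum.mono_neutral_cong_left) (use F G in auto)
  ultimately have "x + y = (\<Sum>b\<in>F \<union> G. ?e b *\<^sub>R b)"
    by (simp add: sum.distrib scaleR_add_left)
  then show "x + y \<in> cone_span B"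
    unfolding cone_span_def using F G
    by (intro CollectI exI[of _ "F \<union> G"] exI[of _ ?e]) auto
next
  fix x and a :: real assume "x \<in> cone_span B" and a: "0 \<le> a"
  then obtain F c where F: "finite F" "F \<subseteq> B" "\<forall>b\<in>F. 0 \<le> c b" "x = (\<Sum>b\<in>F. c b *\<^sub>R b)"
    unfolding cone_span_def by blast
  then show "a *\<^sub>R x \<in> cone_span B"
    unfolding cone_span_def using a
    by (intro CollectI exI[of _ F] exI[of _ "\<lambda>b. a * c b"]) (auto simp: scaleR_sum_right)
qed

lemma convex_cone_sum:
  assumes "convex_cone C" "\<And>i. i \<in> A \<Longrightarrow> f i \<in> C"
  shows "sum f A \<in> C"
  using assms(2)
  by (induction A rule: infinite_finite_induct)
     (auto simp: convex_cone_add[OF assms(1)] convex_cone_contains_0[OF assms(1)])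

lemma cone_span_nonneg:
  assumes "S \<subseteq> nat_points" "x \<in> cone_span S"
  shows "0 \<le> x"
proof -
  obtain F c where "F \<subseteq> S" "\<forall>b\<in>F. 0 \<le> c b" "x = (\<Sum>b\<in>F. c b *\<^sub>R b)"
    using assms(2) unfolding cone_span_def by blast
  then show ?thesis
    using nat_points_nonneg assms(1) by (auto intro!: sum_nonneg scaleR_nonneg_nonneg)
qed

lemma ray_scale: "x \<in> ray v \<Longrightarrow> 0 \<le> c \<Longrightarrow> c *\<^sub>R x \<in> ray v"
  by (force simp: ray_def)

lemma ray_eq:
  assumes "x \<in> ray v" "x \<noteq> 0"
  shows "ray x = ray v"
proof -
  obtain l where l: "x = l *\<^sub>R v" "0 < l"
    using assms by (force simp: ray_def order_le_less)
  have "c *\<^sub>R v \<in> ray x" if "0 \<le> c" for c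
    using that l by (auto simp: ray_def intro!: exI[of _ "c / l"])
  then show ?thesis using ray_scale[OF assms(1)] by (auto simp: ray_def)
qed

text \<open>
  A segment of the cone that meets the ray inside can be rescaled, endpoint by endpoint, to a
  segment of the slice through \<open>e\<close>. Extremality of \<open>e\<close> makes the rescaled segment degenerate, so
  both endpoints are multiples of \<open>e\<close>. An endpoint \<open>0\<close> cannot be rescaled and is treated apart.
\<close>

lemma extreme_point_imp_extremal_ray:
  assumes C: "convex_cone C" and nonneg: "\<And>x. x \<in> C \<Longrightarrow> 0 \<le> x"
    and e: "e extreme_point_of {x \<in> C. norm1 x = 1}"
  shows "extremal_ray (ray e) C"
proof -
  have eC: "e \<in> C" and e1: "norm1 e = 1" using e by (auto simp: extreme_point_of_def)
  have "e \<noteq> 0" using e1 by auto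
  have "a \<in> ray e \<and> b \<in> ray e"
    if a: "a \<in> C" and b: "b \<in> C" and x: "x \<in> ray e" and seg: "x \<in> open_segment a b" for a b x
  proof -
    obtain u where u: "0 < u" "u < 1" "x = (1 - u) *\<^sub>R a + u *\<^sub>R b"
      using seg by (auto simp: in_segment)
    have zero: "0 \<in> ray e" by (auto simp: ray_def intro: exI[of _ 0])
    consider "a = 0" | "b = 0" | "a \<noteq> 0" "b \<noteq> 0" by blast
    then show ?thesis
    proof cases
      case 1
      then have "b = (1 / u) *\<^sub>R x" using u by simp
      then show ?thesis using 1 zero ray_scale[OF x, of "1/u"] u by simp
    next
      case 2
      then have "a = (1 / (1 - u)) *\<^sub>R x" using u by simp
      then show ?thesis using 2 zero ray_scale[OF x, of "1/(1-u)"] u by simp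
    next
      case 3
      define A where "A = norm1 a"
      define B where "B = norm1 b"
      have AB: "0 < A" "0 < B" using 3 norm1_pos by (auto simp: A_def B_def)
      define a' where "a' = (1 / A) *\<^sub>R a"
      define b' where "b' = (1 / B) *\<^sub>R b"
      have a': "a' \<in> {x \<in> C. norm1 x = 1}" and b': "b' \<in> {x \<in> C. norm1 x = 1}"
        using a b AB convex_cone_scaleR[OF C]
        by (auto simp: a'_def b'_def norm1_scaleR A_def[symmetric] B_def[symmetric])
      have aa: "a = A *\<^sub>R a'" and bb: "b = B *\<^sub>R b'" using AB by (auto simp: a'_def b'_def)
      obtain l where l: "0 \<le> l" "x = l *\<^sub>R e" using x by (auto simp: ray_def)
      have "norm1 x = (1 - u) * A + u * B"
        unfolding u(3) using nonneg a b u
        by (subst norm1_add) (auto simp: norm1_scaleR A_def B_def intro!: scaleR_nonneg_nonneg)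
      then have l_eq: "l = (1 - u) * A + u * B" using l e1 by (simp add: norm1_scaleR)
      have lpos: "0 < l" unfolding l_eq using AB u by (simp add: add_pos_pos)
      \<comment> \<open>The weight of \<open>b'\<close> when \<open>e\<close> is written as a convex combination of \<open>a'\<close> and \<open>b'\<close>.\<close>
      define w where "w = u * B / l"
      have w: "0 < w" using u AB lpos by (simp add: w_def)
      have w1: "1 - w = (1 - u) * A / l" using lpos by (simp add: w_def l_eq field_simps)
      then have w2: "w < 1" using u AB lpos by (metis diff_gt_0_iff_gt divide_pos_pos mult_pos_pos)
      have "e = (1 / l) *\<^sub>R x" using l lpos by simp
      also have "\<dots> = (1 - w) *\<^sub>R a' + w *\<^sub>R b'"
        unfolding u(3) w1 by (simp add: aa bb w_def scaleR_add_right)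
      finally have e_eq: "e = (1 - w) *\<^sub>R a' + w *\<^sub>R b'" .
      have "a' = b'"
        using e a' b' e_eq w w2 unfolding extreme_point_of_def in_segment by blast
      then have "a' = e" "b' = e" using e_eq by (auto simp: algebra_simps)
      then show ?thesis using aa bb AB by (auto simp: ray_def intro: less_imp_le)
    qed
  qed
  moreover have "ray e \<subseteq> C" using convex_cone_scaleR[OF C _ eC] by (auto simp: ray_def)
  moreover have "convex (ray e)"
    unfolding convex_alt
  proof clarify
    fix x y and u :: real assume "x \<in> ray e" "y \<in> ray e" and u: "0 \<le> u" "u \<le> 1"
    then obtain k l where "x = k *\<^sub>R e" "y = l *\<^sub>R e" "0 \<le> k" "0 \<le> l" by (auto simp: ray_def)
    then show "(1 - u) *\<^sub>R x + u *\<^sub>R y \<in> ray e"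
      using u by (auto simp: ray_def scaleR_add_left[symmetric] simp del: scaleR_left_distrib
        intro!: exI[of _ "(1 - u) * k + u * l"])
  qed
  ultimately show ?thesis
    unfolding extremal_ray_def face_of_def using \<open>e \<noteq> 0\<close> by blast
qed

text \<open>
  A closed convex cone in the non-negative orthant is generated by its extremal rays. The points of
  1-norm \<open>1\<close> form a compact convex base, which by Krein-Milman is the convex hull of its extreme
  points, and these span extremal rays. Stating the result for an arbitrary convex cone \<open>K\<close> leaves
  open how the elements of the generated cone are represented.
\<close>

lemma closed_cone_subset_if_extremal_rays:
  fixes C :: "(real^'n) set"
  assumes "closed C" and C: "convex_cone C" and nonneg: "\<And>x. x \<in> C \<Longrightarrow> 0 \<le> x"
    and K: "convex_cone K" and rays: "\<And>R. extremal_ray R C \<Longrightarrow> R \<subseteq> K"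
  shows "C \<subseteq> K"
proof
  fix x assume x: "x \<in> C"
  let ?B = "{x \<in> C. norm1 x = 1}"
  have cont: "continuous_on UNIV (norm1 :: real^'n \<Rightarrow> real)"
    unfolding norm1_def by (intro continuous_intros)
  have "norm y \<le> 1" if "y \<in> ?B" for y
    using norm_le_l1_cart[of y] that by (simp add: norm1_def)
  then have "bounded ?B" by (auto simp: bounded_iff)
  moreover have "closed ?B"
  proof -
    have "?B = C \<inter> norm1 -` {1}" by auto
    then show ?thesis
      using closed_vimage[OF _ cont, of "{1}"] \<open>closed C\<close> by auto
  qed
  ultimately have comp: "compact ?B" by (simp add: compact_eq_bounded_closed)
  have conv: "convex ?B"
    unfolding convex_alt
  proof clarify
    fix y z and u :: real
    assume yz: "y \<in> C" "z \<in> C" and n: "norm1 y = 1" "norm1 z = 1" and u: "0 \<le> u" "u \<le> 1"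
    have "norm1 ((1 - u) *\<^sub>R y + u *\<^sub>R z) = 1"
      using n u nonneg yz
      by (subst norm1_add) (auto simp: norm1_scaleR intro!: scaleR_nonneg_nonneg)
    then show "(1 - u) *\<^sub>R y + u *\<^sub>R z \<in> C \<and> norm1 ((1 - u) *\<^sub>R y + u *\<^sub>R z) = 1"
      using convex_cone_add[OF C] convex_cone_scaleR[OF C] yz u by auto
  qed
  have "y \<in> K" if "y extreme_point_of ?B" for y
    using rays[OF extreme_point_imp_extremal_ray[OF C nonneg that]]
    by (auto simp: ray_def dest!: subsetD[of _ K y] intro: exI[of _ 1])
  then have "convex hull {y. y extreme_point_of ?B} \<subseteq> K"
    using K by (intro hull_minimal) (auto simp: convex_cone_def)
  then have B: "?B \<subseteq> K" using Krein_Milman_Minkowski[OF comp conv] by simp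
  show "x \<in> K"
  proof (cases "x = 0")
    case True
    then show ?thesis using convex_cone_contains_0[OF K] by simp
  next
    case False
    then have pos: "0 < norm1 x" by (rule norm1_pos)
    then have "(1 / norm1 x) *\<^sub>R x \<in> ?B"
      using x convex_cone_scaleR[OF C] by (auto simp: norm1_scaleR)
    then have "(1 / norm1 x) *\<^sub>R x \<in> K" using B by blast
    then have "norm1 x *\<^sub>R (1 / norm1 x) *\<^sub>R x \<in> K" by (rule convex_cone_scaleR[OF K norm1_nonneg])
    then show ?thesis using False by simp
  qed
qed

text \<open>
  The midpoint of \<open>y\<close> and \<open>z\<close> is on the ray too; if \<open>y = z\<close>, the open segment is empty and the face
  property says nothing, but then \<open>y\<close> is that midpoint.
\<close>

lemma face_of_cone_add:
  assumes C: "convex_cone C" and F: "ray v face_of C"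
    and y: "y \<in> C" and z: "z \<in> C" and yz: "y + z \<in> ray v"
  shows "y \<in> ray v"
proof (cases "y = z")
  case True
  then have "y = (1/2) *\<^sub>R (y + z)" by (simp only: scaleR_half_double)
  then show ?thesis using ray_scale[OF yz, of "1/2"] by simp
next
  case False
  have "(1/2) *\<^sub>R (y + z) \<in> open_segment y z"
    using False by (auto simp: in_segment scaleR_add_right intro!: exI[of _ "1/2"])
  moreover have "(1/2) *\<^sub>R (y + z) \<in> ray v" by (rule ray_scale[OF yz]) simp
  ultimately show ?thesis using F y z unfolding face_of_def by blast
qed

section \<open>Minimal generators\<close>

definition atoms :: "'a::comm_monoid_add set \<Rightarrow> 'a set" where
  "atoms S = {x \<in> S. x \<noteq> 0 \<and> (\<forall>y\<in>S. \<forall>z\<in>S. x = y + z \<longrightarrow> y = 0 \<or> z = 0)}"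

lemma add_submonoid_hull: "add_submonoid (add_submonoid hull A)"
  by (rule hull_in) (auto simp: add_submonoid_def)

text \<open>
  Removing an atom from \<open>S\<close> leaves a submonoid, so no set of generators can avoid it.
\<close>

lemma atoms_subset_generators:
  assumes "add_submonoid hull A = S"
  shows "atoms S \<subseteq> A"
proof
  fix x assume x: "x \<in> atoms S"
  show "x \<in> A"
  proof (rule ccontr)
    assume "x \<notin> A"
    moreover have "A \<subseteq> S" using hull_subset[of A add_submonoid] assms by simp
    moreover have "add_submonoid (S - {x})"
      using x add_submonoid_hull[of A] unfolding assms
      unfolding add_submonoid_def atoms_def
      by (auto; metis add_0 add_0_right)
    ultimately have "S \<subseteq> S - {x}"
      using hull_minimal[of A "S - {x}" add_submonoid] assms by blast
    then show False using x by (auto simp: atoms_def)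
  qed
qed

lemma hull_atoms:
  assumes S: "add_submonoid S" "S \<subseteq> nat_points"
  shows "add_submonoid hull (atoms S) = S"
proof
  show "add_submonoid hull (atoms S) \<subseteq> S"
    by (rule hull_minimal) (auto simp: atoms_def S(1))
  have "x \<in> S \<Longrightarrow> x \<in> add_submonoid hull (atoms S)" for x
  proof (induction "nat \<lfloor>norm1 x\<rfloor>" arbitrary: x rule: less_induct)
    case less
    note H = add_submonoid_hull[of "atoms S"]
    show ?case
    proof (cases "x = 0 \<or> x \<in> atoms S")
      case True
      then show ?thesis using H hull_subset[of "atoms S" add_submonoid]
        by (auto simp: add_submonoid_def)
    next
      case False
      then obtain y z where yz: "y \<in> S" "z \<in> S" "x = y + z" "y \<noteq> 0" "z \<noteq> 0"
        using less.prems by (auto simp: atoms_def)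
      have np: "y \<in> nat_points" "z \<in> nat_points" using yz S by auto
      then obtain m n where mn: "norm1 y = real m" "norm1 z = real n"
        using norm1_Nats by (metis Nats_cases)
      have "norm1 x = real (m + n)"
        using norm1_add[OF nat_points_nonneg[OF np(1)] nat_points_nonneg[OF np(2)]] yz mn by simp
      moreover have "0 < m" "0 < n" using mn yz norm1_pos[of y] norm1_pos[of z] by auto
      ultimately have "nat \<lfloor>norm1 y\<rfloor> < nat \<lfloor>norm1 x\<rfloor>" "nat \<lfloor>norm1 z\<rfloor> < nat \<lfloor>norm1 x\<rfloor>"
        unfolding mn by simp_all
      then show ?thesis using less.hyps yz H by (auto simp: add_submonoid_def)
    qed
  qed
  then show "S \<subseteq> add_submonoid hull (atoms S)" by blast
qed

text \<open>
  This shows that the definite description in \<open>min_gens\<close> denotes: the atoms generate \<open>S\<close>, and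
  every generating set contains them.
\<close>

lemma min_gens_eq_atoms:
  assumes S: "add_submonoid S" "S \<subseteq> nat_points"
  shows "min_gens S = atoms S"
  unfolding min_gens_def
proof (rule the_equality)
  show "add_submonoid hull (atoms S) = S \<and>
    (\<forall>B. B \<subset> atoms S \<longrightarrow> add_submonoid hull B \<noteq> S)"
    using hull_atoms[OF S] atoms_subset_generators by blast
next
  fix A assume "add_submonoid hull A = S \<and> (\<forall>B. B \<subset> A \<longrightarrow> add_submonoid hull B \<noteq> S)"
  then show "A = atoms S" using hull_atoms[OF S] atoms_subset_generators[of A S] by blast
qed

section \<open>Natural points on an extremal ray\<close>

text \<open>
  The natural points on a ray are the multiples of the shortest non-zero one, \<open>a\<close>. If \<open>k a\<close> is an
  integer vector, then the multiple of \<open>a\<close> by the fractional part of \<open>k\<close> is a natural point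
  shorter than \<open>a\<close>, so it is \<open>0\<close>. Being shortest on a ray also means being componentwise least.
\<close>

lemma ray_vector:
  assumes R: "R = ray v" and b: "b \<in> R" "b \<in> nat_points" "b \<noteq> 0"
  shows "ray_vector R \<in> nat_points" "ray_vector R \<noteq> 0" "R = ray (ray_vector R)"
    and "(\<And>i. (k *\<^sub>R ray_vector R) $ i \<in> \<int>) \<Longrightarrow> k \<in> \<int>"
proof -
  let ?A = "{x. x \<in> R \<and> x \<in> nat_points \<and> x \<noteq> 0}"
  define a where "a = arg_min_on norm1 ?A"
  have Nats: "norm1 ` ?A \<subseteq> \<nat>" and "?A \<noteq> {}" using b norm1_Nats by auto
  note min = arg_min_on_Nats[OF this, folded a_def]
  have a: "a \<in> R" "a \<in> nat_points" "a \<noteq> 0" using min(1) by auto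
  have Ra: "R = ray a" using ray_eq[of a v] a R by simp
  have pos: "0 < norm1 a" using a by (simp add: norm1_pos)
  have least: "a \<le> y" if y: "y \<in> ?A" for y
  proof -
    obtain l where l: "0 \<le> l" "y = l *\<^sub>R a" using y Ra by (auto simp: ray_def)
    then have "1 \<le> l" using min(2)[OF y] pos by (simp add: norm1_scaleR)
    then show ?thesis using l nat_points_nonneg[OF a(2)]
      by (auto simp: less_eq_vec_def intro: mult_right_mono[of 1 l, simplified])
  qed
  have "ray_vector R = a"
    unfolding ray_vector_def
  proof (rule Least_equality)
    fix y assume "y \<in> nat_points \<and> y \<noteq> 0 \<and> R = ray y"
    then show "a \<le> y" by (intro least) (auto simp: ray_def intro: exI[of _ 1])
  qed (use a Ra in auto)
  then show "ray_vector R \<in> nat_points" "ray_vector R \<noteq> 0" "R = ray (ray_vector R)"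
    using a Ra by auto
  assume int: "\<And>i. (k *\<^sub>R ray_vector R) $ i \<in> \<int>"
  define y where "y = frac k *\<^sub>R a"
  have "y $ i \<in> \<int>" for i
  proof -
    have "y $ i = (k *\<^sub>R a) $ i - of_int \<lfloor>k\<rfloor> * a $ i"
      by (simp add: y_def frac_def algebra_simps)
    then show ?thesis
      using int[of i] a(2) \<open>ray_vector R = a\<close> by (auto simp: nat_points_iff)
  qed
  moreover have "0 \<le> y"
    unfolding y_def using nat_points_nonneg[OF a(2)] by (intro scaleR_nonneg_nonneg) auto
  ultimately have "y \<in> nat_points" by (simp add: nat_points_iff)
  moreover have "y \<in> R" unfolding Ra y_def by (auto simp: ray_def)
  moreover have "norm1 y < norm1 a"
    using pos frac_lt_1[of k] by (simp add: y_def norm1_scaleR)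
  ultimately have "y = 0" using min(2)[of y] by force
  then show "k \<in> \<int>" using a(3) by (simp add: y_def)
qed

lemma C_semigroupD:
  assumes "C_semigroup S"
  shows "add_submonoid S" "S \<subseteq> nat_points" "finite (cone_points S - S)"
  using assms add_submonoid_hull unfolding C_semigroup_def affine_semigroup_def by auto

lemma add_submonoid_scale:
  "add_submonoid S \<Longrightarrow> x \<in> S \<Longrightarrow> of_nat n *\<^sub>R x \<in> (S :: 'a::real_vector set)"
  by (induction n) (auto simp: add_submonoid_def scaleR_add_left)

lemma add_submonoid_sum:
  assumes "add_submonoid S" "\<And>i. i \<in> A \<Longrightarrow> f i \<in> S"
  shows "sum f A \<in> S"
  using assms(2)
  by (induction A rule: infinite_finite_induct) (use assms(1) in \<open>auto simp: add_submonoid_def\<close>)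

locale semigroup_ray =
  fixes S R :: "(real^'n) set"
  assumes semigroup: "C_semigroup S"
    and extremal: "extremal_ray R (cone_span S)"
begin

lemmas monoid = C_semigroupD(1)[OF semigroup]
  and S_nat = C_semigroupD(2)[OF semigroup]
  and finite_gaps = C_semigroupD(3)[OF semigroup]

abbreviation a :: "real^'n" where "a \<equiv> ray_vector R"

lemma R_face: "R face_of cone_span S"
  using extremal by (simp add: extremal_ray_def)

lemma R_subset: "R \<subseteq> cone_span S"
  using R_face by (rule face_of_imp_subset)

lemma R_add:
  assumes "y \<in> cone_span S" "z \<in> cone_span S" "y + z \<in> R"
  shows "y \<in> R"
  using face_of_cone_add[OF convex_cone_cone_span] assms extremal
  unfolding extremal_ray_def by blast

text \<open>
  A generator of the ray is a non-negative combination of elements of \<open>S\<close>, and as the ray is a face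
  every term of the combination is on it.
\<close>

lemma ex_semigroup_point: "\<exists>b\<in>S \<inter> R. b \<noteq> 0"
proof -
  obtain v where v: "v \<noteq> 0" "R = ray v" using extremal by (auto simp: extremal_ray_def)
  have "v \<in> R" unfolding v by (auto simp: ray_def intro: exI[of _ 1])
  then have "v \<in> cone_span S" using R_subset by blast
  then obtain F c where F: "finite F" "F \<subseteq> S" "\<forall>b\<in>F. 0 \<le> c b" "v = (\<Sum>b\<in>F. c b *\<^sub>R b)"
    unfolding cone_span_def by blast
  then obtain b where b: "b \<in> F" "c b *\<^sub>R b \<noteq> 0"
    using sum.neutral[of F "\<lambda>b. c b *\<^sub>R b"] v(1) by auto
  have term_in: "c g *\<^sub>R g \<in> cone_span S" if "g \<in> F" for g
    using F that cone_span_superset[of S] convex_cone_scaleR[OF convex_cone_cone_span] by blast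
  have "c b *\<^sub>R b + (\<Sum>g\<in>F - {b}. c g *\<^sub>R g) = v"
    using F b by (simp add: sum.remove)
  moreover have "(\<Sum>g\<in>F - {b}. c g *\<^sub>R g) \<in> cone_span S"
    using term_in by (intro convex_cone_sum[OF convex_cone_cone_span]) auto
  ultimately have "c b *\<^sub>R b \<in> R"
    using R_add[OF term_in[OF b(1)]] \<open>v \<in> R\<close> by simp
  then have "(1 / c b) *\<^sub>R (c b *\<^sub>R b) \<in> R"
    using F(3) b(1) unfolding v(2) by (metis ray_scale zero_le_divide_1_iff)
  then have "b \<in> R" using b(2) by simp
  then show ?thesis using F(2) b by auto
qed

text \<open>
  The shortest non-zero element of \<open>S\<close> on the ray is an atom of \<open>S\<close>, not only of \<open>S \<inter> R\<close>, because
  both summands of a point of a face are in the face.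
\<close>

lemma ex_min_gen: "min_gens S \<inter> R \<noteq> {}"
proof -
  let ?A = "{b \<in> S \<inter> R. b \<noteq> 0}"
  define b where "b = arg_min_on norm1 ?A"
  have "norm1 ` ?A \<subseteq> \<nat>" "?A \<noteq> {}" using norm1_Nats S_nat ex_semigroup_point by auto
  note min = arg_min_on_Nats[OF this, folded b_def]
  have "y = 0 \<or> z = 0" if "y \<in> S" "z \<in> S" "b = y + z" for y z
  proof (rule ccontr)
    assume "\<not> (y = 0 \<or> z = 0)"
    moreover have "y \<in> R"
      using R_add[of y z] that min(1) cone_span_superset[of S] by auto
    ultimately have "norm1 b \<le> norm1 y" using min(2)[of y] that by auto
    moreover have "norm1 b = norm1 y + norm1 z"
      unfolding that(3) using that S_nat by (intro norm1_add nat_points_nonneg) auto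
    ultimately show False using norm1_pos[of z] \<open>\<not> (y = 0 \<or> z = 0)\<close> by simp
  qed
  then have "b \<in> atoms S" using min(1) by (auto simp: atoms_def)
  then show ?thesis using min(1) min_gens_eq_atoms[OF monoid S_nat] by auto
qed

lemma a_nat: "a \<in> nat_points" and a_nonzero: "a \<noteq> 0" and R_eq: "R = ray a"
  and coeff_Ints: "(\<And>i. (k *\<^sub>R a) $ i \<in> \<int>) \<Longrightarrow> k \<in> \<int>"
proof -
  obtain v where v: "R = ray v" using extremal by (auto simp: extremal_ray_def)
  obtain b where "b \<in> R" "b \<in> nat_points" "b \<noteq> 0" using ex_semigroup_point S_nat by auto
  note * = ray_vector[OF v this]
  show "a \<in> nat_points" "a \<noteq> 0" "R = ray a" by fact+
  show "(\<And>i. (k *\<^sub>R a) $ i \<in> \<int>) \<Longrightarrow> k \<in> \<int>" by (rule *(4))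
qed

lemma R_iff: "x \<in> R \<longleftrightarrow> (\<exists>l\<ge>0. x = l *\<^sub>R a)"
  using R_eq by (auto simp: ray_def)

lemma a_in_R: "a \<in> R"
  by (auto simp: R_iff intro: exI[of _ 1])

lemma R_scale: "x \<in> R \<Longrightarrow> 0 \<le> c \<Longrightarrow> c *\<^sub>R x \<in> R"
  using R_eq ray_scale by metis

lemma ray_coeff: "ray_coeff R (l *\<^sub>R a) = l"
  unfolding ray_coeff_def using a_nonzero by (intro the_equality) auto

lemma nat_point_on_ray:
  assumes "x \<in> R" "x \<in> nat_points"
  obtains n :: nat where "x = real n *\<^sub>R a"
proof -
  obtain l where l: "0 \<le> l" "x = l *\<^sub>R a" using assms by (auto simp: R_iff)
  have "(l *\<^sub>R a) $ i \<in> \<int>" for i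
    using assms(2) unfolding l(2) nat_points_iff by blast
  then have "l \<in> \<int>" by (rule coeff_Ints)
  then have "l \<in> \<nat>" using l(1) by (simp add: Nats_altdef2)
  then obtain n where "l = real n" by (rule Nats_cases)
  then show ?thesis by (intro that[of n]) (simp add: l(2))
qed

lemma ray_coeff_Nats: "x \<in> R \<Longrightarrow> x \<in> nat_points \<Longrightarrow> ray_coeff R x \<in> \<nat>"
  by (erule (1) nat_point_on_ray) (simp add: ray_coeff)

lemma ray_min_gen:
  shows "ray_min_gen S R \<in> S" "ray_min_gen S R \<in> R" "ray_min_gen S R \<noteq> 0"
proof -
  note gens = min_gens_eq_atoms[OF monoid S_nat]
  have "ray_coeff R ` (min_gens S \<inter> R) \<subseteq> \<nat>"
    using ray_coeff_Nats S_nat by (auto simp: gens atoms_def)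
  then have "ray_min_gen S R \<in> min_gens S \<inter> R"
    unfolding ray_min_gen_def using ex_min_gen by (rule arg_min_on_Nats(1))
  then show "ray_min_gen S R \<in> S" "ray_min_gen S R \<in> R" "ray_min_gen S R \<noteq> 0"
    by (auto simp: gens atoms_def)
qed

lemma beyond_conductor:
  assumes x: "x \<in> R" "x \<in> nat_points" and long: "norm1 (conductor S R) \<le> norm1 x"
  shows "x \<in> S"
proof (rule ccontr)
  assume "x \<notin> S"
  let ?G = "R \<inter> (cone_points S - S)"
  have xG: "x \<in> ?G" using x \<open>x \<notin> S\<close> R_subset by (auto simp: cone_points_def)
  have fin: "finite ?G" using finite_gaps by simp
  have ne: "?G \<noteq> {}" using xG by auto
  have f_eq: "frobenius S R = arg_max_on (ray_coeff R) ?G"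
    using ne by (auto simp: frobenius_def)
  note max = arg_max_on_finite[where f = "ray_coeff R", OF fin ne, folded f_eq]
  obtain n where n: "x = real n *\<^sub>R a" using nat_point_on_ray x by blast
  have "frobenius S R \<in> R" "frobenius S R \<in> nat_points" using max(1) by (auto simp: cone_points_def)
  then obtain m where m: "frobenius S R = real m *\<^sub>R a" using nat_point_on_ray by blast
  have "n \<le> m" using max(2)[OF xG] by (simp add: n m ray_coeff)
  moreover have "conductor S R = (real m + 1) *\<^sub>R a"
    by (simp add: conductor_def m scaleR_add_left)
  then have "real m + 1 \<le> real n"
    using long norm1_pos[OF a_nonzero] by (simp add: n norm1_scaleR)
  ultimately show False by simp
qed

text \<open>
  The difference \<open>w - m\<close> is an integer multiple \<open>k a\<close> of the ray vector. Linearity of the 1-norm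
  on natural points gives \<open>norm1 w - norm1 m = k * norm1 a\<close>, so \<open>k\<close> is not negative and \<open>k a\<close> is
  beyond the conductor.
\<close>

lemma far_point_in_semigroup:
  assumes w: "w \<in> nat_points" and m: "m \<in> S" and par: "w - m \<in> span R"
    and long: "norm1 (conductor S R) + norm1 m \<le> norm1 w"
  shows "w \<in> S"
proof -
  have "span R = span {a}"
  proof
    have "R \<subseteq> span {a}" by (auto simp: R_iff span_singleton intro: rangeI)
    then show "span R \<subseteq> span {a}" by (simp add: span_minimal)
    show "span {a} \<subseteq> span R" using a_in_R by (intro span_mono) auto
  qed
  then obtain k where k: "w - m = k *\<^sub>R a" using par by (auto simp: span_singleton)
  have mn: "m \<in> nat_points" using m S_nat by auto
  have "(k *\<^sub>R a) $ i \<in> \<int>" for i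
    unfolding k[symmetric] using w mn by (auto simp: nat_points_iff)
  then have kZ: "k \<in> \<int>" by (rule coeff_Ints)
  have "norm1 w - norm1 m = k * norm1 a"
  proof -
    have "norm1 w = (\<Sum>i\<in>UNIV. m $ i + k * a $ i)"
    proof -
      have "\<bar>w $ i\<bar> = m $ i + k * a $ i" for i
      proof -
        have "0 \<le> w $ i" using nat_points_nonneg[OF w] by (simp add: less_eq_vec_def)
        then show ?thesis using arg_cong[OF k, of "\<lambda>z. z $ i"] by simp
      qed
      then show ?thesis by (simp add: norm1_def)
    qed
    moreover have "norm1 m = (\<Sum>i\<in>UNIV. m $ i)" "norm1 a = (\<Sum>i\<in>UNIV. a $ i)"
      using nat_points_nonneg[OF mn] nat_points_nonneg[OF a_nat]
      by (auto simp: norm1_def less_eq_vec_def)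
    ultimately show ?thesis by (simp add: sum.distrib sum_distrib_left)
  qed
  then have le: "norm1 (conductor S R) \<le> k * norm1 a" using long by simp
  then have "0 \<le> k * norm1 a" using norm1_nonneg order_trans by blast
  then have k0: "0 \<le> k" using norm1_pos[OF a_nonzero] by (simp add: zero_le_mult_iff)
  then obtain n where n: "k = real n" using kZ by (metis Nats_altdef2 Nats_cases mem_Collect_eq)
  have "k *\<^sub>R a \<in> S"
  proof (rule beyond_conductor)
    show "k *\<^sub>R a \<in> R" using R_scale[OF a_in_R k0] .
    show "k *\<^sub>R a \<in> nat_points" unfolding n by (rule nat_points_scale[OF a_nat])
    show "norm1 (conductor S R) \<le> norm1 (k *\<^sub>R a)" using le k0 by (simp add: norm1_scaleR)
  qed
  moreover have "w = m + k *\<^sub>R a" using k by (simp add: algebra_simps)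
  ultimately show ?thesis using m monoid by (simp add: add_submonoid_def)
qed

text \<open>
  All the translates are in the cone, and only finitely many of them can be gaps.
\<close>

lemma translate_in_semigroup:
  assumes "d \<in> cone_points S"
  obtains n :: nat where "d + real n *\<^sub>R a \<in> S"
proof (rule ccontr)
  assume none: "\<not> thesis"
  let ?f = "\<lambda>n::nat. d + real n *\<^sub>R a"
  have "a \<in> cone_span S" using R_subset a_in_R by blast
  then have "?f n \<in> cone_points S" for n
    using assms nat_points_add nat_points_scale[OF a_nat]
      convex_cone_add[OF convex_cone_cone_span[of S]]
      convex_cone_scaleR[OF convex_cone_cone_span[of S]]
    by (auto simp: cone_points_def)
  then have "range ?f \<subseteq> cone_points S - S" using none that by auto
  then have "finite (range ?f)" using finite_gaps by (rule finite_subset)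
  moreover have "inj ?f" using a_nonzero by (auto simp: inj_on_def)
  ultimately show False using finite_imageD infinite_UNIV_nat by blast
qed

lemma shortest_long_point:
  "arg_min_on (ray_coeff R) {x \<in> R \<inter> S. N \<le> norm1 x} \<in> {x \<in> R \<inter> S. N \<le> norm1 x}"
proof (rule arg_min_on_Nats(1))
  show "ray_coeff R ` {x \<in> R \<inter> S. N \<le> norm1 x} \<subseteq> \<nat>"
    using ray_coeff_Nats S_nat by auto
  let ?s = "ray_min_gen S R"
  obtain n :: nat where "N < real n * norm1 ?s"
    using norm1_pos[OF ray_min_gen(3)] reals_Archimedean3 by blast
  moreover have "real n *\<^sub>R ?s \<in> R \<inter> S"
    using add_submonoid_scale[OF monoid ray_min_gen(1)] R_scale[OF ray_min_gen(2)] by simp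
  ultimately show "{x \<in> R \<inter> S. N \<le> norm1 x} \<noteq> {}"
    by (auto simp: norm1_scaleR intro!: exI[of _ "real n *\<^sub>R ?s"])
qed

end

section \<open>The bounding points\<close>

lemma lin_form_add: "lin_form c (x + y) = lin_form c x + lin_form c y"
  by (simp add: lin_form_def algebra_simps sum.distrib)

lemma lin_form_diff: "lin_form c (x - y) = lin_form c x - lin_form c y"
  by (simp add: lin_form_def algebra_simps sum_subtractf)

lemma closed_if_supported_hyperplanes:
  assumes "supported_hyperplanes C t h"
  shows "closed C"
proof -
  have "C = (\<Inter>k. {x. 0 \<le> x $ k}) \<inter> (\<Inter>j\<in>{1..t}. {x. 0 \<le> lin_form (h j) x})"
    using assms unfolding supported_hyperplanes_def by auto
  moreover have "closed \<dots>"
    unfolding lin_form_def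
    by (intro closed_Int closed_INT ballI closed_Collect_le continuous_intros)
  ultimately show ?thesis by simp
qed

theorem mainTheorem2:
  fixes S :: "(real^'n) set"
    and h :: "nat \<Rightarrow> int^'n"
    and \<tau> :: "nat \<Rightarrow> (real^'n) set"
    and t q :: nat
  assumes "C_semigroup S"
    and "supported_hyperplanes (cone_span S) t h"
    and "bij_betw \<tau> {1..q} {R. extremal_ray R (cone_span S)}"
    and "\<And>i. i \<in> {1..q} \<Longrightarrow> card (ray_index t h (\<tau> i)) = CARD('n) - 1"
    and "\<And>i. i \<in> {1..q} \<Longrightarrow> level_line h (ray_index t h (\<tau> i)) (\<lambda>_. 0) = span (\<tau> i)"
  shows "(\<forall>i\<in>{1..q}. \<forall>\<alpha>\<in>nonzero_levels S t h q \<tau> i.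
            level_line h (ray_index t h (\<tau> i)) \<alpha> \<inter> S \<noteq> {}) \<and>
         cone_points S - S \<subseteq> zonotope q (\<lambda>i. bound_point S t h q \<tau> i)"
proof -
  note monoid = C_semigroupD(1)[OF assms(1)] and S_nat = C_semigroupD(2)[OF assms(1)]
  have ray: "semigroup_ray S (\<tau> i)" if "i \<in> {1..q}" for i
    using assms(1,3) that by (auto simp: semigroup_ray_def bij_betw_def)
  define s where "s i = ray_min_gen S (\<tau> i)" for i
  define x where "x i = bound_point S t h q \<tau> i" for i
  define J where "J i = ray_index t h (\<tau> i)" for i
  have s: "s i \<in> S" "s i \<in> \<tau> i" "s i \<noteq> 0" if "i \<in> {1..q}" for i
    using semigroup_ray.ray_min_gen[OF ray[OF that]] by (auto simp: s_def)
  have s_nat: "s i \<in> nat_points" if "i \<in> {1..q}" for i using s[OF that] S_nat by auto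
  have s_nonneg: "0 \<le> s i" if "i \<in> {1..q}" for i using s_nat[OF that] by (rule nat_points_nonneg)
  have s_C: "s i \<in> cone_span S" if "i \<in> {1..q}" for i
    using s[OF that] cone_span_superset by blast
  have J_zero: "lin_form (h j) y = 0" if "j \<in> J i" "y \<in> \<tau> i" for i j y
    using that by (auto simp: J_def ray_index_def)
  have parallel: "y - z \<in> span (\<tau> i)"
    if "i \<in> {1..q}" "\<And>j. j \<in> J i \<Longrightarrow> lin_form (h j) y = lin_form (h j) z" for i y z
    using assms(5)[OF that(1)] that(2) by (auto simp: level_line_def J_def lin_form_diff)

  have D_points: "D_set S q \<tau> \<subseteq> cone_points S"
  proof
    fix d assume "d \<in> D_set S q \<tau>"
    then obtain l where l: "\<forall>i\<in>{1..q}. 0 \<le> l i" "d = (\<Sum>i\<in>{1..q}. l i *\<^sub>R s i)"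
      "d \<in> nat_points" by (auto simp: D_set_def zonotope_def s_def)
    have "d \<in> cone_span S" unfolding l(2)
      using l(1) s_C by (intro convex_cone_sum convex_cone_scaleR convex_cone_cone_span) auto
    then show "d \<in> cone_points S" using l by (simp add: cone_points_def)
  qed
  have "D_set S q \<tau> \<subseteq> {y. y \<in> nat_points \<and> norm1 y \<le> (\<Sum>i\<in>{1..q}. norm1 (s i))}"
  proof
    fix d assume "d \<in> D_set S q \<tau>"
    then obtain l where l: "\<forall>i\<in>{1..q}. 0 \<le> l i \<and> l i \<le> 1" "d = (\<Sum>i\<in>{1..q}. l i *\<^sub>R s i)"
      "d \<in> nat_points" by (auto simp: D_set_def zonotope_def s_def)
    have "norm1 d = (\<Sum>i\<in>{1..q}. norm1 (l i *\<^sub>R s i))" unfolding l(2)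
      using l(1) s_nonneg by (intro norm1_sum scaleR_nonneg_nonneg) auto
    also have "\<dots> \<le> (\<Sum>i\<in>{1..q}. norm1 (s i))"
      using l(1) by (intro sum_mono) (auto simp: norm1_scaleR intro: mult_left_le_one_le)
    finally show "d \<in> {y. y \<in> nat_points \<and> norm1 y \<le> (\<Sum>i\<in>{1..q}. norm1 (s i))}"
      using l by simp
  qed
  then have "finite (D_set S q \<tau>)" using finite_nat_points_bounded by (rule finite_subset)
  then have finite_levels: "finite (nonzero_levels S t h q \<tau> i)" for i
    by (simp add: nonzero_levels_def)

  have nonempty: "level_line h (J i) \<alpha> \<inter> S \<noteq> {}"
    if i: "i \<in> {1..q}" and \<alpha>: "\<alpha> \<in> nonzero_levels S t h q \<tau> i" for i \<alpha>
  proof -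
    interpret semigroup_ray S "\<tau> i" by (rule ray[OF i])
    obtain d where d: "d \<in> D_set S q \<tau>" "\<alpha> = form_values h (J i) d"
      using \<alpha> by (auto simp: nonzero_levels_def J_def)
    obtain n :: nat where n: "d + real n *\<^sub>R ray_vector (\<tau> i) \<in> S"
      using translate_in_semigroup d(1) D_points by blast
    have "real n *\<^sub>R ray_vector (\<tau> i) \<in> \<tau> i"
      using R_scale[OF a_in_R] by simp
    then have "d + real n *\<^sub>R ray_vector (\<tau> i) \<in> level_line h (J i) \<alpha>"
      using J_zero by (auto simp: level_line_def d(2) form_values_def lin_form_add)
    then show ?thesis using n by blast
  qed

  have x: "x i \<in> \<tau> i" "norm_bound S t h q \<tau> i \<le> norm1 (x i)" if "i \<in> {1..q}" for i
    using semigroup_ray.shortest_long_point[OF ray[OF that], of "norm_bound S t h q \<tau> i"]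
    by (auto simp: x_def bound_point_def)

  \<comment> \<open>On level \<open>0\<close> the semigroup element \<open>0\<close> takes the place of the shortest point; this is where
    the \<open>0\<close> inserted into the maximum is used.\<close>
  have long_in_S: "d + w \<in> S"
    if i: "i \<in> {1..q}" and d: "d \<in> D_set S q \<tau>" and w: "w \<in> \<tau> i" "w \<in> nat_points"
      and long: "norm_bound S t h q \<tau> i \<le> norm1 (d + w)" for i d w
  proof -
    interpret semigroup_ray S "\<tau> i" by (rule ray[OF i])
    let ?M = "insert 0 ((\<lambda>\<alpha>. norm1 (level_min S h (J i) \<alpha>)) ` nonzero_levels S t h q \<tau> i)"
    have finM: "finite ?M" using finite_levels by simp
    have bound: "norm1 (conductor S (\<tau> i)) + r \<le> norm1 (d + w)" if "r \<in> ?M" for r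
      using Max_ge[OF finM that] long by (simp add: norm_bound_def J_def)
    have dw: "d + w \<in> nat_points" using d w by (intro nat_points_add) (auto simp: D_set_def)
    have same: "lin_form (h j) (d + w) = form_values h (J i) d j" if "j \<in> J i" for j
      using that J_zero w by (simp add: form_values_def lin_form_add)
    define \<alpha> where "\<alpha> = form_values h (J i) d"
    show "d + w \<in> S"
    proof (cases "\<alpha> \<in> nonzero_levels S t h q \<tau> i")
      case True
      let ?m = "level_min S h (J i) \<alpha>"
      have "?m \<in> level_line h (J i) \<alpha> \<inter> S"
        unfolding level_min_def using nonempty[OF i True] norm1_Nats S_nat
        by (intro arg_min_on_Nats(1)) auto
      then have m: "?m \<in> S" "\<And>j. j \<in> J i \<Longrightarrow> lin_form (h j) (d + w) = lin_form (h j) ?m"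
        using same by (auto simp: level_line_def \<alpha>_def)
      then show ?thesis
        using True by (intro far_point_in_semigroup[OF dw m(1) parallel[OF i m(2)]] bound) auto
    next
      case False
      then have "\<alpha> = (\<lambda>j\<in>J i. 0)" using d by (auto simp: nonzero_levels_def \<alpha>_def J_def)
      then have "d + w - 0 \<in> span (\<tau> i)"
        using same by (intro parallel[OF i]) (auto simp: \<alpha>_def lin_form_def)
      then show ?thesis
        using monoid bound[of 0] by (intro far_point_in_semigroup[OF dw, of 0]) (auto simp: add_submonoid_def)
    qed
  qed

  let ?K = "{\<Sum>i\<in>{1..q}. \<mu> i *\<^sub>R s i | \<mu>. \<forall>i\<in>{1..q}. 0 \<le> \<mu> i}"
  have "cone_span S \<subseteq> ?K"
  proof (rule closed_cone_subset_if_extremal_rays)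
    show "closed (cone_span S)" using assms(2) by (rule closed_if_supported_hyperplanes)
    show "convex_cone (cone_span S)" by (rule convex_cone_cone_span)
    show "\<And>y. y \<in> cone_span S \<Longrightarrow> 0 \<le> y" using cone_span_nonneg S_nat by blast
    show "convex_cone ?K"
      unfolding convex_cone_iff
    proof (intro conjI ballI allI impI)
      show "0 \<in> ?K" by (intro CollectI exI[of _ "\<lambda>_. 0"]) auto
    next
      fix y z assume "y \<in> ?K" "z \<in> ?K"
      then obtain \<mu> \<nu> where "\<forall>i\<in>{1..q}. 0 \<le> \<mu> i" "y = (\<Sum>i\<in>{1..q}. \<mu> i *\<^sub>R s i)"
        "\<forall>i\<in>{1..q}. 0 \<le> \<nu> i" "z = (\<Sum>i\<in>{1..q}. \<nu> i *\<^sub>R s i)" by blast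
      then show "y + z \<in> ?K"
        by (intro CollectI exI[of _ "\<lambda>i. \<mu> i + \<nu> i"]) (auto simp: scaleR_add_left sum.distrib)
    next
      fix y and c :: real assume "y \<in> ?K" "0 \<le> c"
      then obtain \<mu> where "\<forall>i\<in>{1..q}. 0 \<le> \<mu> i" "y = (\<Sum>i\<in>{1..q}. \<mu> i *\<^sub>R s i)" by blast
      then show "c *\<^sub>R y \<in> ?K"
        using \<open>0 \<le> c\<close> by (intro CollectI exI[of _ "\<lambda>i. c * \<mu> i"]) (auto simp: scaleR_sum_right)
    qed
    fix R assume "extremal_ray R (cone_span S)"
    then have "R \<in> \<tau> ` {1..q}" using assms(3) by (simp add: bij_betw_def)
    then obtain i where i: "i \<in> {1..q}" "R = \<tau> i" by blast
    have "\<tau> i = ray (s i)"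
      using semigroup_ray.R_eq[OF ray[OF i(1)]] s[OF i(1)] ray_eq by metis
    show "R \<subseteq> ?K"
    proof
      fix y assume "y \<in> R"
      then obtain l where l: "0 \<le> l" "y = l *\<^sub>R s i"
        using i \<open>\<tau> i = ray (s i)\<close> by (auto simp: ray_def)
      have "y = (\<Sum>k\<in>{1..q}. (if k = i then l else 0) *\<^sub>R s k)"
        using i by (simp add: l(2) if_distrib[of "\<lambda>c. c *\<^sub>R _"] cong: if_cong)
      then show "y \<in> ?K" using l(1) by (intro CollectI exI[of _ "\<lambda>k. if k = i then l else 0"]) auto
    qed
  qed
  note generated = this

  have "P \<in> zonotope q x" if P: "P \<in> cone_points S - S" for P
  proof -
    obtain \<mu> where \<mu>: "\<And>i. i \<in> {1..q} \<Longrightarrow> 0 \<le> \<mu> i" and P_eq: "P = (\<Sum>i\<in>{1..q}. \<mu> i *\<^sub>R s i)"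
    proof -
      have "P \<in> ?K" using P generated by (auto simp only: cone_points_def)
      then show ?thesis using that by blast
    qed
    have short: "norm1 (\<mu> i *\<^sub>R s i) \<le> norm1 (x i)" if i: "i \<in> {1..q}" for i
    proof (rule ccontr)
      assume "\<not> ?thesis"
      then have gt: "norm1 (x i) < norm1 (\<mu> i *\<^sub>R s i)" by simp
      define n where "n k = nat \<lfloor>\<mu> k\<rfloor>" for k
      have \<mu>_eq: "\<mu> k = real (n k) + frac (\<mu> k)" if "k \<in> {1..q}" for k
        using \<mu>[OF that] by (simp add: n_def frac_def)
      define d where "d = (\<Sum>k\<in>{1..q}. frac (\<mu> k) *\<^sub>R s k)"
      have P_split: "P = d + (\<Sum>k\<in>{1..q}. real (n k) *\<^sub>R s k)"
        unfolding P_eq d_def sum.distrib[symmetric] scaleR_add_left[symmetric]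
        using \<mu>_eq by (intro sum.cong) (auto simp: add.commute)
      have d_nonneg: "0 \<le> d"
        unfolding d_def using s_nonneg by (intro sum_nonneg scaleR_nonneg_nonneg) auto
      have "d $ j \<in> \<int>" for j
      proof -
        have "d $ j = P $ j - (\<Sum>k\<in>{1..q}. real (n k) * s k $ j)" unfolding P_split by simp
        then show ?thesis using P s_nat by (auto simp: cone_points_def nat_points_iff)
      qed
      then have d_nat: "d \<in> nat_points" using d_nonneg by (simp add: nat_points_iff)
      have "d \<in> zonotope q s"
        unfolding zonotope_def d_def by (auto intro!: exI[of _ "\<lambda>k. frac (\<mu> k)"] simp: less_imp_le frac_lt_1)
      then have dD: "d \<in> D_set S q \<tau>" using d_nat by (simp add: D_set_def s_def[abs_def])
      let ?w = "real (n i) *\<^sub>R s i"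
      have w_nat: "?w \<in> nat_points" using nat_points_scale[OF s_nat[OF i]] by simp
      have "norm1 (\<mu> i *\<^sub>R s i) = norm1 (frac (\<mu> i) *\<^sub>R s i) + norm1 ?w"
      proof -
        have "norm1 (\<mu> i *\<^sub>R s i) = (real (n i) + frac (\<mu> i)) * norm1 (s i)"
          unfolding norm1_scaleR using \<mu>[OF i] \<mu>_eq[OF i] by (metis abs_of_nonneg)
        then show ?thesis by (simp add: norm1_scaleR distrib_right)
      qed
      also have "norm1 (frac (\<mu> i) *\<^sub>R s i) \<le> norm1 d"
      proof -
        have "norm1 d = (\<Sum>k\<in>{1..q}. norm1 (frac (\<mu> k) *\<^sub>R s k))"
          unfolding d_def using s_nonneg by (intro norm1_sum scaleR_nonneg_nonneg) auto
        also have "\<dots> \<ge> norm1 (frac (\<mu> i) *\<^sub>R s i)" using i by (intro member_le_sum) auto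
        finally show ?thesis .
      qed
      finally have "norm1 (\<mu> i *\<^sub>R s i) \<le> norm1 (d + ?w)"
        using norm1_add[OF d_nonneg nat_points_nonneg[OF w_nat]] by simp
      then have long: "norm_bound S t h q \<tau> i \<le> norm1 (d + ?w)" using gt x(2)[OF i] by simp
      have "?w \<in> \<tau> i"
        using semigroup_ray.R_scale[OF ray[OF i] s(2)[OF i]] by simp
      then have "d + ?w \<in> S" using long_in_S[OF i dD _ w_nat long] by blast
      moreover have "(\<Sum>k\<in>{1..q} - {i}. real (n k) *\<^sub>R s k) \<in> S"
        using s by (intro add_submonoid_sum[OF monoid] add_submonoid_scale[OF monoid]) auto
      moreover have "P = (d + ?w) + (\<Sum>k\<in>{1..q} - {i}. real (n k) *\<^sub>R s k)"
        unfolding P_split using i by (simp add: sum.remove add.assoc)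
      ultimately have "P \<in> S" using monoid by (simp add: add_submonoid_def)
      then show False using P by simp
    qed
    have "\<exists>l. 0 \<le> l \<and> l \<le> 1 \<and> \<mu> i *\<^sub>R s i = l *\<^sub>R x i" if i: "i \<in> {1..q}" for i
    \<comment> \<open>The bounding point is \<open>0\<close> if \<open>norm_bound\<close> is \<open>0\<close>.\<close>
    proof (cases "x i = 0")
      case True
      then have "\<mu> i *\<^sub>R s i = 0" using short[OF i] norm1_nonneg norm1_eq_0_iff
        by (metis norm1_zero order_antisym)
      then show ?thesis using True by (intro exI[of _ 0]) auto
    next
      case False
      have "\<mu> i *\<^sub>R s i \<in> ray (x i)"
        using semigroup_ray.R_eq[OF ray[OF i]] s(2)[OF i] x(1)[OF i] ray_eq[OF _ False] \<mu>[OF i] ray_scale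
        by metis
      then obtain l where l: "0 \<le> l" "\<mu> i *\<^sub>R s i = l *\<^sub>R x i" by (auto simp: ray_def)
      then have "l * norm1 (x i) \<le> 1 * norm1 (x i)"
        using short[OF i] by (simp add: norm1_scaleR)
      then have "l \<le> 1" using norm1_pos[OF False] by (simp only: mult_le_cancel_right_pos)
      then show ?thesis using l by blast
    qed
    then obtain l where l: "\<And>i. i \<in> {1..q} \<Longrightarrow> 0 \<le> l i \<and> l i \<le> 1 \<and> \<mu> i *\<^sub>R s i = l i *\<^sub>R x i"
      by metis
    then have "P = (\<Sum>i\<in>{1..q}. l i *\<^sub>R x i)" unfolding P_eq by (intro sum.cong) auto
    then show ?thesis unfolding zonotope_def using l by blast
  qed
  then show ?thesis using nonempty by (auto simp: J_def x_def[abs_def])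
qed

end
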